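(* Let $k\geqslant 1$ and $m\geqslant 1$ be integers. Then $$R_k(k^2m)=R_k(m)+(k^2-k)m.$$
   Context: A set $A\subset \mathbb{Z}/n\mathbb{Z}$ is called $k$-free if for all $x\in A$, $kx\notin A$. $R_k(n)$ denotes the maximal cardinality of a $k$-free subset of $\mathbb{Z}/n\mathbb{Z}$. *)

theory Defs
  imports "HOL-Number_Theory.Residues"
begin

text \<open>
  \<open>\<int>/n\<int>\<close> is \<^term>\<open>residue_ring (int n)\<close>, with carrier \<open>{0..n-1}\<close>; this is also the
  right ring for \<open>n = 1\<close> (carrier \<open>{0}\<close>), a case excluded by the locale \<open>residues\<close>.
  The product \<open>kx\<close> is the \<open>k\<close>-fold sum of \<open>x\<close> in that ring.
\<close>

definition k_free :: "nat \<Rightarrow> nat \<Rightarrow> int set \<Rightarrow> bool" where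
  "k_free k n A \<longleftrightarrow>
     A \<subseteq> carrier (residue_ring (int n)) \<and>
     (\<forall>x\<in>A. [k] \<cdot>\<^bsub>residue_ring (int n)\<^esub> x \<notin> A)"

definition R :: "nat \<Rightarrow> nat \<Rightarrow> nat" where
  "R k n = Max (card ` {A. k_free k n A})"

lemma residue_ring_add_pow:
  assumes "n \<ge> 1"
  shows "[k] \<cdot>\<^bsub>residue_ring (int n)\<^esub> x = (int k * x) mod int n"
proof (induction k)
  case 0
  then show ?case by (simp add: add_pow_def residue_ring_def nat_pow_def)
next
  case (Suc k)
  then show ?case
    by (simp add: add_pow_def residue_ring_def nat_pow_def algebra_simps mod_simps)
qed

lemma k_free_iff:
  assumes "n \<ge> 1"
  shows "k_free k n A \<longleftrightarrow> A \<subseteq> {0..<int n} \<and> (\<forall>x\<in>A. (int k * x) mod int n \<notin> A)"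
  using residue_ring_add_pow[OF assms]
  by (auto simp: k_free_def residue_ring_def)

lemma finite_k_free: "finite {A. k_free k n A}"
  by (rule finite_subset[of _ "Pow {0..int n - 1}"])
     (auto simp: k_free_def residue_ring_def)

lemma k_free_empty: "k_free k n {}"
  by (simp add: k_free_def)

text \<open>The maximum in \<open>R\<close> is over a finite nonempty set, so it is attained.\<close>

lemma R_attained: "\<exists>A. k_free k n A \<and> card A = R k n"
proof -
  have "R k n \<in> card ` {A. k_free k n A}"
    unfolding R_def using finite_k_free k_free_empty by (intro Max_in) blast+
  then show ?thesis by auto
qed

lemma card_le_R: "k_free k n A \<Longrightarrow> card A \<le> R k n"
  unfolding R_def using finite_k_free by (intro Max_ge) auto

end

theory Submission
  imports Defs
begin

text \<open>
  Multiplication by \<open>k\<close> on the multiples of \<open>k\<^sup>2\<close> modulo \<open>k\<^sup>2m\<close> is a copy of multiplication by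
  \<open>k\<close> on \<open>\<int>/m\<int>\<close>, so these contribute at most \<open>R k m\<close> elements.  If \<open>k\<close> divides \<open>u \<in> A\<close> but
  \<open>k\<^sup>2\<close> does not, replace \<open>u\<close> by \<open>u div k\<close>: it is not a multiple of \<open>k\<close>, and it lies outside \<open>A\<close>
  because \<open>A\<close> is \<open>k\<close>-free.  So the remaining part of \<open>A\<close> is at most as large as the set of
  non-multiples of \<open>k\<close>.  Conversely, all non-multiples of \<open>k\<close> together with \<open>k\<^sup>2 B\<close> form a
  \<open>k\<close>-free set whenever \<open>B\<close> is \<open>k\<close>-free modulo \<open>m\<close>.
\<close>

lemma card_non_multiples:
  fixes k n :: nat
  assumes "k \<ge> 1"
  shows "card {x \<in> {0..<int (k * n)}. \<not> int k dvd x} = k * n - n"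
proof -
  have multiples: "{x \<in> {0..<int (k * n)}. int k dvd x} = (*) (int k) ` {0..<int n}"
    using assms by (auto simp: dvd_def zero_le_mult_iff)
  have "card ((*) (int k) ` {0..<int n}) = n"
    using assms by (subst card_image) (auto simp: inj_on_def)
  moreover have "{x \<in> {0..<int (k * n)}. \<not> int k dvd x}
      = {0..<int (k * n)} - (*) (int k) ` {0..<int n}"
    unfolding multiples[symmetric] by auto
  moreover have "(*) (int k) ` {0..<int n} \<subseteq> {0..<int (k * n)}"
    unfolding multiples[symmetric] by auto
  ultimately show ?thesis by (simp add: card_Diff_subset del: of_nat_mult)
qed

text \<open>Scaling a product and its modulus by \<open>k^2\<close> scales the remainder. Hence
  \<open>y\<close> to \<open>k^2 y\<close> carries multiplication by \<open>k\<close> mod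
  \<open>m\<close> to that mod \<open>k^2 m\<close>, on which both transfers of
  \<open>k\<close>-freeness rest.\<close>

lemma mult_mod_square:
  fixes k m :: nat
  shows "int k * (int k ^ 2 * y) mod int (k\<^sup>2 * m) = int k ^ 2 * (int k * y mod int m)"
  unfolding mult_mod_right of_nat_mult of_nat_power by (simp only: mult.left_commute)

lemma k_free_lift:
  fixes k m :: nat
  assumes "k \<ge> 1" "m \<ge> 1" "k_free k m B"
  shows "k_free k (k\<^sup>2 * m)
    ({x \<in> {0..<int (k\<^sup>2 * m)}. \<not> int k dvd x} \<union> (*) (int k ^ 2) ` B)"
    (is "k_free k ?n (?U \<union> ?V)")
proof -
  have n: "?n \<ge> 1" using assms by simp
  have B: "B \<subseteq> {0..<int m}" and B_free: "\<And>x. x \<in> B \<Longrightarrow> int k * x mod int m \<notin> B"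
    using assms by (auto simp: k_free_iff)
  have V_sub: "?V \<subseteq> {0..<int ?n}" using B assms by auto
  \<comment> \<open>As \<open>k\<close> divides the modulus, every reduced product stays a multiple
    of \<open>k\<close>, hence outside \<open>?U\<close>; only \<open>?V\<close> remains to be
    avoided.\<close>
  have k_dvd: "int k dvd int k * x mod int ?n" for x
    by (simp add: dvd_mod power2_eq_square)
  have "int k * x mod int ?n \<notin> ?V" if "x \<in> ?U" for x
  proof
    assume "int k * x mod int ?n \<in> ?V"
    then have "int k ^ 2 dvd int k * x mod int ?n" by auto
    then have "int k ^ 2 dvd int k * x" by (simp add: dvd_mod_iff)
    then have "int k dvd x" using assms by (simp add: power2_eq_square)
    with that show False by simp
  qed
  moreover have "int k * x mod int ?n \<notin> ?V" if x: "x \<in> ?V" for x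
  proof -
    obtain y where "y \<in> B" "x = int k ^ 2 * y" using x by auto
    then show ?thesis using B_free[of y] assms mult_mod_square[of k y m] by auto
  qed
  ultimately show ?thesis
    unfolding k_free_iff[OF n] using V_sub k_dvd by blast
qed

lemma k_free_descend:
  fixes k m :: nat
  assumes "k \<ge> 1" "m \<ge> 1" "k_free k (k\<^sup>2 * m) A"
  shows "k_free k m {y. int k ^ 2 * y \<in> A}"
proof -
  have n: "k\<^sup>2 * m \<ge> 1" using assms by simp
  have A: "A \<subseteq> {0..<int (k\<^sup>2 * m)}"
    and A_free: "\<And>x. x \<in> A \<Longrightarrow> int k * x mod int (k\<^sup>2 * m) \<notin> A"
    using assms(3) unfolding k_free_iff[OF n] by auto
  \<comment> \<open>\<open>y\<close> ranges over all integers; the bounds on \<open>A\<close>,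
    divided by \<open>k^2\<close>, confine it to residues mod \<open>m\<close>.\<close>
  have "0 \<le> y \<and> y < int m" if "int k ^ 2 * y \<in> A" for y
  proof -
    have "0 \<le> int k ^ 2 * y" "int k ^ 2 * y < int k ^ 2 * int m" using that A by auto
    then show ?thesis using assms(1) by (auto simp: zero_le_mult_iff)
  qed
  then show ?thesis
    unfolding k_free_iff[OF assms(2)] using A_free mult_mod_square[of k _ m] by fastforce
qed

lemma card_k_free_non_square_multiples:
  fixes k m :: nat
  assumes "k \<ge> 1" "m \<ge> 1" "k_free k (k\<^sup>2 * m) A"
  shows "card {x \<in> A. \<not> int k ^ 2 dvd x} \<le> (k\<^sup>2 - k) * m"
proof -
  have n: "k\<^sup>2 * m \<ge> 1" using assms by simp
  have A: "A \<subseteq> {0..<int (k\<^sup>2 * m)}"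
    and A_free: "\<And>x. x \<in> A \<Longrightarrow> int k * x mod int (k\<^sup>2 * m) \<notin> A"
    using assms(3) unfolding k_free_iff[OF n] by auto
  let ?S = "{x \<in> A. \<not> int k ^ 2 dvd x}"
  \<comment> \<open>Bracketed so that \<open>card_non_multiples\<close> applies with
    \<open>n = k * m\<close>.\<close>
  let ?T = "{x \<in> {0..<int (k * (k * m))}. \<not> int k dvd x}"
  define g where "g x = (if int k dvd x then x div int k else x)" for x
  have kn: "int k > 0" using assms by simp
  have div_notin: "x div int k \<notin> A" if "x \<in> A" "int k dvd x" for x
  proof
    assume "x div int k \<in> A"
    then have "int k * (x div int k) mod int (k\<^sup>2 * m) \<notin> A" by (rule A_free)
    moreover have "x mod int (k\<^sup>2 * m) = x" using that A by (intro mod_pos_pos_trivial) auto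
    ultimately show False using that by simp
  qed
  have "inj_on g ?S"
  proof (rule inj_onI)
    fix x y assume xy: "x \<in> ?S" "y \<in> ?S" and eq: "g x = g y"
    \<comment> \<open>If only \<open>x\<close> were divisible by \<open>k\<close>, then
      \<open>x div k = y\<close> would lie in \<open>A\<close>, against \<open>div_notin\<close>;
      likewise with \<open>x\<close> and \<open>y\<close> swapped.\<close>
    have "int k dvd x \<longleftrightarrow> int k dvd y"
      using eq div_notin[of x] div_notin[of y] xy unfolding g_def by (metis (lifting) mem_Collect_eq)
    then show "x = y"
      using eq unfolding g_def by (metis dvd_mult_div_cancel)
  qed
  moreover have "g ` ?S \<subseteq> ?T"
  proof (rule image_subsetI)
    fix x assume x: "x \<in> ?S"
    then have bounds: "0 \<le> x" "x < int (k * (k * m))"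
      using A by (auto simp: power2_eq_square mult.assoc)
    show "g x \<in> ?T"
    proof (cases "int k dvd x")
      case True
      then obtain z where z: "x = int k * z" ..
      have "z \<ge> 0" using bounds z kn by (simp add: zero_le_mult_iff)
      moreover have "z \<le> x" using z \<open>z \<ge> 0\<close> kn by (simp add: mult_le_cancel_right1)
      moreover have "\<not> int k dvd z" using x z kn by (auto simp: power2_eq_square)
      moreover have "g x = z" using z kn by (simp add: g_def)
      ultimately show ?thesis using bounds by auto
    qed (use bounds in \<open>simp add: g_def\<close>)
  qed
  moreover have "finite ?T" by (rule finite_subset[of _ "{0..<int (k * (k * m))}"]) auto
  ultimately have "card ?S \<le> card ?T" by (rule card_inj_on_le)
  also have "\<dots> = k * (k * m) - k * m" by (rule card_non_multiples[OF assms(1)])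
  finally show ?thesis by (simp add: power2_eq_square diff_mult_distrib mult.assoc)
qed

theorem theorem3:
  fixes k m :: nat
  assumes "k \<ge> 1" and "m \<ge> 1"
  shows "R k (k^2 * m) = R k m + (k^2 - k) * m"
proof (rule antisym)
  obtain A where A: "k_free k (k\<^sup>2 * m) A" and card_A: "card A = R k (k\<^sup>2 * m)"
    using R_attained by blast
  let ?B = "{y. int k ^ 2 * y \<in> A}"
  \<comment> \<open>The image consists of exactly the multiples of \<open>k^2\<close> in
    \<open>A\<close>.\<close>
  have split: "A = (*) (int k ^ 2) ` ?B \<union> {x \<in> A. \<not> int k ^ 2 dvd x}"
    by (auto elim: dvdE)
  have "card A \<le> card ((*) (int k ^ 2) ` ?B) + card {x \<in> A. \<not> int k ^ 2 dvd x}"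
    by (subst split) (rule card_Un_le)
  also have "card ((*) (int k ^ 2) ` ?B) = card ?B"
    using assms by (intro card_image) (auto simp: inj_on_def)
  also have "card ?B \<le> R k m" by (intro card_le_R k_free_descend assms A)
  also have "card {x \<in> A. \<not> int k ^ 2 dvd x} \<le> (k\<^sup>2 - k) * m"
    by (intro card_k_free_non_square_multiples assms A)
  finally show "R k (k^2 * m) \<le> R k m + (k^2 - k) * m" by (simp add: card_A)
next
  obtain B where B: "k_free k m B" and card_B: "card B = R k m"
    using R_attained by blast
  let ?U = "{x \<in> {0..<int (k\<^sup>2 * m)}. \<not> int k dvd x}"
  let ?V = "(*) (int k ^ 2) ` B"
  have "finite B" using B assms by (auto simp: k_free_iff intro: finite_subset)
  moreover have "finite ?U" by (rule finite_subset[of _ "{0..<int (k\<^sup>2 * m)}"]) auto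
  \<comment> \<open>Every element of \<open>?V\<close> is a multiple of \<open>k^2\<close>, hence of
    \<open>k\<close>.\<close>
  moreover have "?U \<inter> ?V = {}" by auto
  ultimately have "card (?U \<union> ?V) = card ?U + card ?V"
    by (intro card_Un_disjoint) auto
  also have "card ?V = R k m"
    unfolding card_B[symmetric] using assms by (intro card_image) (auto simp: inj_on_def)
  also have "card ?U = (k\<^sup>2 - k) * m"
    using card_non_multiples[OF assms(1), of "k * m"]
    by (simp add: power2_eq_square diff_mult_distrib mult.assoc)
  finally show "R k m + (k^2 - k) * m \<le> R k (k^2 * m)"
    using card_le_R[OF k_free_lift[OF assms B]] by simp
qed

end
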